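(* Let $n$ be a positive integer. A linear map $\phi: S_n^+\rightarrow S_n^+$ satisfies $$\alpha(\phi(X))=\alpha(X)\quad\text{for all } X\in S_n^+$$ if and only if all off-diagonal entries of the matrix $H:=\phi(J_n-I_n)$ are positive and there is an $n\times n$ permutation matrix $P$ such that $$\phi(X)=H\circ(P^TXP)\quad\text{for all } X\in S_n^+.$$
   Context: $S_n^+$ is the set of $n\times n$ (entrywise) nonnegative real symmetric matrices with zero trace (so all diagonal entries are zero). A map $\phi:S_n^+\to S_n^+$ is linear if $\phi(aX+bY)=a\phi(X)+b\phi(Y)$ for all $X,Y\in S_n^+$ and all real $a,b\ge 0$. The independence number $\alpha(A)$ of a square matrix $A$ is the maximum order of its principal zero submatrices. $J_n$ is the $n\times n$ all-ones matrix, $I_n$ is the identity matrix, and $A\circ B$ is the Hadamard (entrywise) product. *)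

theory Defs
  imports "HOL-Analysis.Analysis"
begin

definition nonneg_sym_zero_trace :: "(real ^ 'n ^ 'n) set" where
  "nonneg_sym_zero_trace =
    {X. (\<forall>i j. 0 \<le> X $ i $ j) \<and> transpose X = X \<and> trace X = 0}"

text \<open>Maps between these cones are total functions on the ambient matrix space; only their
  values on the cone are constrained.\<close>

definition cone_linear_map :: "(real ^ 'n ^ 'n \<Rightarrow> real ^ 'n ^ 'n) \<Rightarrow> bool" where
  "cone_linear_map \<phi> \<longleftrightarrow>
    (\<forall>X \<in> nonneg_sym_zero_trace. \<phi> X \<in> nonneg_sym_zero_trace) \<and>
    (\<forall>X \<in> nonneg_sym_zero_trace. \<forall>Y \<in> nonneg_sym_zero_trace. \<forall>a b. 0 \<le> a \<longrightarrow> 0 \<le> b \<longrightarrow>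
      \<phi> (a *\<^sub>R X + b *\<^sub>R Y) = a *\<^sub>R \<phi> X + b *\<^sub>R \<phi> Y)"

text \<open>The index set \<open>I\<close> selects the principal submatrix with rows and columns in \<open>I\<close>, of order
  \<open>card I\<close>. The empty submatrix is admitted, so the maximum is over a nonempty finite set even
  if no diagonal entry vanishes.\<close>

definition independence_number :: "real ^ 'n ^ 'n \<Rightarrow> nat" where
  "independence_number A = Max {card I | I. \<forall>i\<in>I. \<forall>j\<in>I. A $ i $ j = 0}"

definition permutation_matrix :: "real ^ 'n ^ 'n \<Rightarrow> bool" where
  "permutation_matrix P \<longleftrightarrow>
    (\<forall>i j. P $ i $ j = 0 \<or> P $ i $ j = 1) \<and>
    (\<forall>i. \<exists>!j. P $ i $ j = 1) \<and> (\<forall>j. \<exists>!i. P $ i $ j = 1)"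

definition all_ones :: "real ^ 'n ^ 'n" where
  "all_ones = (\<chi> i j. 1)"

definition hadamard :: "real ^ 'n ^ 'n \<Rightarrow> real ^ 'n ^ 'n \<Rightarrow> real ^ 'n ^ 'n" where
  "hadamard A B = (\<chi> i j. A $ i $ j * B $ i $ j)"

end

theory Submission
  imports Defs
begin

text \<open>Let \<open>S\<^sub>k\<close> be the adjacency matrix of the full star centred at \<open>k\<close>. Its independence number is
  at least \<open>n - 1\<close>, so \<open>\<phi> S\<^sub>k\<close> is supported in a star with some centre \<open>\<sigma> k\<close>. Since any \<open>n - 1\<close>
  stars cover the complete graph and \<open>H\<close> has no zero off the diagonal, \<open>\<sigma>\<close> takes at least \<open>n - 1\<close>
  values on every set of \<open>n - 1\<close> vertices, which for \<open>n \<ge> 3\<close> forces \<open>\<sigma>\<close> to be a bijection. A matrix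
  vanishing on the edge \<open>ij\<close> is dominated by a combination of the stars with centres other than \<open>i\<close>
  and \<open>j\<close>, so its image vanishes at the edge \<open>\<sigma> i \<sigma> j\<close>; hence the entry of \<open>\<phi> X\<close> there is a
  multiple of \<open>X\<^bsub>ij\<^esub>\<close> alone.\<close>

section \<open>Independent sets and the independence number\<close>

abbreviation independent :: "real ^ 'n ^ 'n \<Rightarrow> 'n set \<Rightarrow> bool" where
  "independent A I \<equiv> \<forall>i\<in>I. \<forall>j\<in>I. A $ i $ j = 0"

lemma card_le_independence_number:
  fixes A :: "real ^ 'n ^ 'n"
  assumes "independent A I"
  shows "card I \<le> independence_number A"
  unfolding independence_number_def using assms by (intro Max_ge) auto

lemma independence_number_attained:
  fixes A :: "real ^ 'n ^ 'n"
  obtains I where "independent A I" "card I = independence_number A"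
proof -
  have "independence_number A \<in> {card I | I. independent A I}"
    unfolding independence_number_def by (rule Max_in) auto
  then show ?thesis using that by auto
qed

text \<open>The image under \<open>p\<close> of a maximum independent set of \<open>A\<close> is
  independent in \<open>B\<close>, and injectivity keeps its size.\<close>

lemma independence_number_le_reindex:
  fixes A B :: "real ^ 'n ^ 'n"
  assumes "inj p" and "\<And>i j. A $ i $ j = 0 \<Longrightarrow> B $ p i $ p j = 0"
  shows "independence_number A \<le> independence_number B"
proof -
  obtain I where I: "independent A I" "card I = independence_number A"
    by (rule independence_number_attained)
  have "card (p ` I) \<le> independence_number B"
    using I(1) assms(2) by (intro card_le_independence_number) auto
  then show ?thesis
    using I(2) assms(1) by (simp add: card_image inj_on_subset)
qed

section \<open>The cone, its edges and its stars\<close>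

lemma mem_cone_iff:
  fixes X :: "real ^ 'n ^ 'n"
  shows "X \<in> nonneg_sym_zero_trace \<longleftrightarrow>
    (\<forall>i j. 0 \<le> X $ i $ j) \<and> (\<forall>i j. X $ i $ j = X $ j $ i) \<and> (\<forall>i. X $ i $ i = 0)"
proof -
  have "transpose X = X \<longleftrightarrow> (\<forall>i j. X $ i $ j = X $ j $ i)"
    by (auto simp: transpose_def vec_eq_iff)
  \<comment> \<open>A sum of nonnegative diagonal entries vanishes only if each of them
    does.\<close>
  moreover have "trace X = 0 \<longleftrightarrow> (\<forall>i. X $ i $ i = 0)" if "\<forall>i j. 0 \<le> X $ i $ j"
    using that by (simp add: trace_def sum_nonneg_eq_0_iff)
  ultimately show ?thesis
    by (auto simp: nonneg_sym_zero_trace_def)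
qed

lemma complete_mem_cone:
  "(all_ones - mat 1 :: real ^ 'n ^ 'n) \<in> nonneg_sym_zero_trace"
  by (auto simp: mem_cone_iff all_ones_def mat_def)

text \<open>The guard \<open>i \<noteq> j\<close> makes \<open>edge p p\<close> the zero matrix, so
  that \<open>edge p q\<close> lies in the cone for all \<open>p\<close> and
  \<open>q\<close>.\<close>

definition edge :: "'n \<Rightarrow> 'n \<Rightarrow> real ^ 'n ^ 'n" where
  "edge p q = (\<chi> i j. if i \<noteq> j \<and> {i, j} = {p, q} then 1 else 0)"

lemma edge_mem_cone: "edge p q \<in> nonneg_sym_zero_trace"
  by (auto simp: mem_cone_iff edge_def)

definition star :: "'n \<Rightarrow> real ^ 'n ^ 'n" where
  "star k = (\<chi> i j. if i \<noteq> j \<and> (i = k \<or> j = k) then 1 else 0)"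

lemma star_mem_cone: "star k \<in> nonneg_sym_zero_trace"
  by (auto simp: mem_cone_iff star_def)

lemma scaleR_mem_cone:
  "X \<in> nonneg_sym_zero_trace \<Longrightarrow> 0 \<le> c \<Longrightarrow> c *\<^sub>R X \<in> nonneg_sym_zero_trace"
  by (auto simp: mem_cone_iff)

lemma sum_mem_cone:
  "(\<And>s. s \<in> S \<Longrightarrow> f s \<in> nonneg_sym_zero_trace) \<Longrightarrow> sum f S \<in> nonneg_sym_zero_trace"
  by (auto simp: mem_cone_iff intro!: sum_nonneg sum.cong sum.neutral)

section \<open>Linear maps of the cone: monotonicity and vanishing entries\<close>

context
  fixes \<phi> :: "real ^ 'n ^ 'n \<Rightarrow> real ^ 'n ^ 'n"
  assumes lin: "cone_linear_map \<phi>"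
begin

lemma map_mem_cone: "X \<in> nonneg_sym_zero_trace \<Longrightarrow> \<phi> X \<in> nonneg_sym_zero_trace"
  using lin by (auto simp: cone_linear_map_def)

lemma map_add:
  assumes "X \<in> nonneg_sym_zero_trace" "Y \<in> nonneg_sym_zero_trace"
  shows "\<phi> (X + Y) = \<phi> X + \<phi> Y"
proof -
  have "\<phi> (1 *\<^sub>R X + 1 *\<^sub>R Y) = 1 *\<^sub>R \<phi> X + 1 *\<^sub>R \<phi> Y"
    using lin assms unfolding cone_linear_map_def by (meson zero_le_one)
  then show ?thesis by simp
qed

lemma map_scaleR:
  assumes "X \<in> nonneg_sym_zero_trace" "0 \<le> c"
  shows "\<phi> (c *\<^sub>R X) = c *\<^sub>R \<phi> X"
proof -
  have "\<phi> (c *\<^sub>R X + 0 *\<^sub>R X) = c *\<^sub>R \<phi> X + 0 *\<^sub>R \<phi> X"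
    using lin assms unfolding cone_linear_map_def by (meson order_refl)
  then show ?thesis by simp
qed

lemma map_sum:
  assumes "finite S" "\<And>s. s \<in> S \<Longrightarrow> f s \<in> nonneg_sym_zero_trace"
  shows "\<phi> (sum f S) = (\<Sum>s\<in>S. \<phi> (f s))"
  using assms
proof (induction S rule: finite_induct)
  case empty
  \<comment> \<open>The zero matrix is 0 times a cone element, here a star, so homogeneity gives
    \<open>\<phi> 0 = 0\<close>.\<close>
  show ?case using map_scaleR[OF star_mem_cone, of 0] by simp
next
  case (insert s S)
  then show ?case by (simp add: map_add sum_mem_cone)
qed

text \<open>Entrywise domination puts \<open>Y - X\<close> into the cone, so its image is
  nonnegative and additivity applies.\<close>

lemma map_mono:
  assumes "X \<in> nonneg_sym_zero_trace" "Y \<in> nonneg_sym_zero_trace"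
    and "\<And>i j. X $ i $ j \<le> Y $ i $ j"
  shows "\<phi> X $ a $ b \<le> \<phi> Y $ a $ b"
proof -
  have D: "Y - X \<in> nonneg_sym_zero_trace"
    using assms by (auto simp: mem_cone_iff)
  have "\<phi> Y = \<phi> X + \<phi> (Y - X)"
    using map_add[OF assms(1) D] by simp
  moreover have "0 \<le> \<phi> (Y - X) $ a $ b"
    using map_mem_cone[OF D] by (simp add: mem_cone_iff)
  ultimately show ?thesis by simp
qed

text \<open>Here \<open>S\<close> is a vertex cover of the graph of \<open>Y\<close>. A large
  multiple of the sum of the stars centred in \<open>S\<close> dominates \<open>Y\<close>, and
  monotonicity bounds the entry by 0.\<close>

lemma map_eq_0_of_star_cover:
  assumes Y: "Y \<in> nonneg_sym_zero_trace"
    and cover: "\<And>i j. i \<notin> S \<Longrightarrow> j \<notin> S \<Longrightarrow> Y $ i $ j = 0"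
    and zero: "\<And>s. s \<in> S \<Longrightarrow> \<phi> (star s) $ a $ b = 0"
  shows "\<phi> Y $ a $ b = 0"
proof -
  \<comment> \<open>The sum of all entries is a crude bound for each single entry.\<close>
  define c where "c = (\<Sum>i\<in>UNIV. \<Sum>j\<in>UNIV. Y $ i $ j)"
  have nonneg: "0 \<le> Y $ i $ j" for i j
    using Y by (simp add: mem_cone_iff)
  have le_c: "Y $ i $ j \<le> c" for i j
  proof -
    have "Y $ i $ j \<le> (\<Sum>j\<in>UNIV. Y $ i $ j)"
      by (rule member_le_sum) (auto simp: nonneg)
    also have "\<dots> \<le> c"
      unfolding c_def by (rule member_le_sum) (auto intro: sum_nonneg nonneg)
    finally show ?thesis .
  qed
  have c: "0 \<le> c"
    using nonneg le_c order_trans by blast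
  let ?Z = "\<Sum>s\<in>S. star s"
  have Z: "?Z \<in> nonneg_sym_zero_trace"
    by (simp add: sum_mem_cone star_mem_cone)
  have "Y $ i $ j \<le> (c *\<^sub>R ?Z) $ i $ j" for i j
  proof (cases "i = j \<or> i \<notin> S \<and> j \<notin> S")
    case True
    then have "Y $ i $ j = 0"
      using Y cover by (auto simp: mem_cone_iff)
    moreover have "0 \<le> (c *\<^sub>R ?Z) $ i $ j"
      using scaleR_mem_cone[OF Z c] unfolding mem_cone_iff by blast
    ultimately show ?thesis by simp
  next
    case False
    then obtain s where s: "s \<in> S" "s = i \<or> s = j" and "i \<noteq> j"
      by blast
    then have "star s $ i $ j = 1"
      by (auto simp: star_def)
    \<comment> \<open>One star through the edge already contributes 1, and the others are
      nonnegative.\<close>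
    moreover have "star s $ i $ j \<le> (\<Sum>s\<in>S. star s $ i $ j)"
      using s(1) by (intro member_le_sum) (auto simp: star_def)
    ultimately have "c * 1 \<le> c * (\<Sum>s\<in>S. star s $ i $ j)"
      by (intro mult_left_mono c) simp
    then show ?thesis
      using le_c[of i j] by simp
  qed
  then have "\<phi> Y $ a $ b \<le> \<phi> (c *\<^sub>R ?Z) $ a $ b"
    by (intro map_mono Y scaleR_mem_cone Z c)
  also have "\<dots> = 0"
    using zero by (simp add: map_scaleR[OF Z c] map_sum star_mem_cone)
  finally show ?thesis
    using map_mem_cone[OF Y] by (simp add: mem_cone_iff order_antisym)
qed

text \<open>Removing from \<open>Z\<close> its part on the edge \<open>ij\<close> leaves a matrix
  covered by the stars at other vertices, whose images vanish at the edge in question because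
  \<open>\<sigma>\<close> is injective. So the entry is \<open>Z $ i $ j\<close> times a constant,
  which the complete graph identifies as the entry of its image.\<close>

lemma entry_formula:
  fixes \<sigma> :: "'n \<Rightarrow> 'n"
  assumes "inj \<sigma>"
    and \<sigma>: "\<And>k a b. a \<noteq> \<sigma> k \<Longrightarrow> b \<noteq> \<sigma> k \<Longrightarrow> \<phi> (star k) $ a $ b = 0"
    and X: "X \<in> nonneg_sym_zero_trace" and "i \<noteq> j"
  shows "\<phi> X $ \<sigma> i $ \<sigma> j = \<phi> (all_ones - mat 1) $ \<sigma> i $ \<sigma> j * X $ i $ j"
proof -
  have *: "\<phi> Z $ \<sigma> i $ \<sigma> j = Z $ i $ j * \<phi> (edge i j) $ \<sigma> i $ \<sigma> j"
    if Z: "Z \<in> nonneg_sym_zero_trace" for Z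
  proof -
    define Y where "Y = Z - (Z $ i $ j) *\<^sub>R edge i j"
    have sym: "Z $ j $ i = Z $ i $ j" and nonneg: "0 \<le> Z $ i $ j"
      using Z by (auto simp: mem_cone_iff)
    have Y: "Y \<in> nonneg_sym_zero_trace"
      using Z sym by (auto simp: mem_cone_iff Y_def edge_def doubleton_eq_iff)
    have "\<phi> Y $ \<sigma> i $ \<sigma> j = 0"
    proof (rule map_eq_0_of_star_cover[OF Y, where S = "- {i, j}"])
      show "Y $ p $ q = 0" if "p \<notin> - {i, j}" "q \<notin> - {i, j}" for p q
        using that Z sym \<open>i \<noteq> j\<close> by (auto simp: mem_cone_iff Y_def edge_def)
      show "\<phi> (star s) $ \<sigma> i $ \<sigma> j = 0" if "s \<in> - {i, j}" for s
        using that \<open>inj \<sigma>\<close> by (intro \<sigma>) (auto dest: injD)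
    qed
    moreover have "\<phi> Z = \<phi> ((Z $ i $ j) *\<^sub>R edge i j) + \<phi> Y"
      using map_add[OF scaleR_mem_cone[OF edge_mem_cone[of i j] nonneg] Y] by (simp add: Y_def)
    ultimately show ?thesis
      by (simp add: map_scaleR edge_mem_cone nonneg)
  qed
  show ?thesis
    using *[OF X] *[OF complete_mem_cone] \<open>i \<noteq> j\<close> by (simp add: all_ones_def mat_def)
qed

section \<open>Maps that preserve the independence number\<close>

context
  assumes pres: "\<forall>X\<in>nonneg_sym_zero_trace. independence_number (\<phi> X) = independence_number X"
begin

text \<open>A zero entry would make \<open>{a, b}\<close> independent in the image, while
  independent sets of the complete graph have at most one vertex.\<close>

lemma complete_image_pos:
  assumes "a \<noteq> b"
  shows "0 < \<phi> (all_ones - mat 1) $ a $ b"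
proof (rule ccontr)
  let ?H = "\<phi> (all_ones - mat 1)"
  assume "\<not> 0 < ?H $ a $ b"
  moreover have H: "?H \<in> nonneg_sym_zero_trace"
    by (rule map_mem_cone[OF complete_mem_cone])
  ultimately have "?H $ a $ b = 0" "?H $ b $ a = 0"
    by (auto simp: mem_cone_iff order_antisym not_less)
  then have "independent ?H {a, b}"
    using H by (auto simp: mem_cone_iff)
  then have "card {a, b} \<le> independence_number ?H"
    by (rule card_le_independence_number)
  also have "\<dots> = independence_number (all_ones - mat 1 :: real ^ 'n ^ 'n)"
    using pres complete_mem_cone by blast
  finally have two: "2 \<le> independence_number (all_ones - mat 1 :: real ^ 'n ^ 'n)"
    using assms by simp
  obtain I where I: "independent (all_ones - mat 1 :: real ^ 'n ^ 'n) I"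
      "card I = independence_number (all_ones - mat 1 :: real ^ 'n ^ 'n)"
    by (rule independence_number_attained)
  have "i = j" if "i \<in> I" "j \<in> I" for i j
    using I(1)[rule_format, OF that] by (auto simp: all_ones_def mat_def split: if_splits)
  then have "card I \<le> Suc 0"
    by (auto simp: card_le_Suc0_iff_eq)
  with two I(2) show False by simp
qed

text \<open>The complement of \<open>k\<close> is independent in the star, so a maximum independent
  set of the image omits at most one vertex, which serves as centre.\<close>

lemma star_image_centre:
  "\<exists>m. \<forall>a b. a \<noteq> m \<longrightarrow> b \<noteq> m \<longrightarrow> \<phi> (star k) $ a $ b = 0"
proof -
  obtain I where I: "independent (\<phi> (star k)) I" "card I = independence_number (\<phi> (star k))"
    by (rule independence_number_attained)
  have "independent (star k) (- {k})"
    by (auto simp: star_def)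
  then have "card (- {k}) \<le> card I"
    using card_le_independence_number I(2) pres star_mem_cone by metis
  then have "card (- I) \<le> Suc 0"
    by (simp add: card_Diff_subset Compl_eq_Diff_UNIV)
  \<comment> \<open>If no vertex is omitted, any \<open>m\<close> will do.\<close>
  then obtain m where "- I \<subseteq> {m}"
    by (cases "- I = {}") (auto simp: card_le_Suc0_iff_eq)
  then have "a \<in> I" if "a \<noteq> m" for a
    using that by blast
  then show ?thesis using I(1) by blast
qed

text \<open>If \<open>k\<close> and \<open>l\<close> shared a centre, the stars at all vertices but
  a third one \<open>m\<close> would still cover the complete graph, yet have at most
  \<open>n - 2\<close> centres. Two distinct vertices would avoid these, and the image of the
  complete graph would vanish there.\<close>

lemma star_image_centre_inj:
  fixes \<sigma> :: "'n \<Rightarrow> 'n"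
  assumes \<sigma>: "\<And>k a b. a \<noteq> \<sigma> k \<Longrightarrow> b \<noteq> \<sigma> k \<Longrightarrow> \<phi> (star k) $ a $ b = 0"
    and card: "3 \<le> CARD('n)"
  shows "inj \<sigma>"
proof (rule injI, rule ccontr)
  fix k l assume eq: "\<sigma> k = \<sigma> l" and "k \<noteq> l"
  have "card {k, l} < CARD('n)"
    using card by (simp add: card_insert_if)
  then have "{k, l} \<noteq> UNIV"
    by (metis less_irrefl)
  then obtain m where m: "m \<noteq> k" "m \<noteq> l"
    by auto
  \<comment> \<open>Leaving out \<open>k\<close> besides \<open>m\<close> loses no centre, since
    \<open>l\<close> remains and has the same one.\<close>
  let ?T = "\<sigma> ` (- {m, k})"
  have "card ?T \<le> card (- {m, k})"
    by (rule card_image_le) simp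
  also have "\<dots> = CARD('n) - 2"
    using m by (simp add: card_Diff_subset Compl_eq_Diff_UNIV)
  finally have "\<not> card (- ?T) \<le> Suc 0"
    using card by (simp add: card_Diff_subset Compl_eq_Diff_UNIV)
  then obtain a b where ab: "a \<notin> ?T" "b \<notin> ?T" "a \<noteq> b"
    by (auto simp: card_le_Suc0_iff_eq)
  have image: "\<sigma> s \<in> ?T" if "s \<noteq> m" for s
  proof (cases "s = k")
    case True
    then show ?thesis using eq \<open>k \<noteq> l\<close> m by auto
  qed (use that in auto)
  have "\<phi> (all_ones - mat 1) $ a $ b = 0"
  proof (rule map_eq_0_of_star_cover[OF complete_mem_cone, where S = "- {m}"])
    show "(all_ones - mat 1 :: real ^ 'n ^ 'n) $ i $ j = 0" if "i \<notin> - {m}" "j \<notin> - {m}" for i j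
      using that by (simp add: all_ones_def mat_def)
    show "\<phi> (star s) $ a $ b = 0" if "s \<in> - {m}" for s
      using that image[of s] ab by (intro \<sigma>) auto
  qed
  with complete_image_pos[OF ab(3)] show False by simp
qed

text \<open>On two vertices both ends of an edge are centres, so chosen centres need not be
  distinct; for \<open>n \<le> 2\<close> the identity is taken instead.\<close>

lemma star_image_centre_bij:
  obtains \<sigma> :: "'n \<Rightarrow> 'n" where "bij \<sigma>"
    and "\<And>k a b. a \<noteq> \<sigma> k \<Longrightarrow> b \<noteq> \<sigma> k \<Longrightarrow> \<phi> (star k) $ a $ b = 0"
proof (cases "3 \<le> CARD('n)")
  case True
  obtain \<sigma> where \<sigma>: "\<And>k a b. a \<noteq> \<sigma> k \<Longrightarrow> b \<noteq> \<sigma> k \<Longrightarrow> \<phi> (star k) $ a $ b = 0"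
    using star_image_centre by metis
  then have "inj \<sigma>"
    using True by (rule star_image_centre_inj)
  then have "bij \<sigma>"
    by (simp add: bij_def finite_UNIV_inj_surj)
  with \<sigma> that show ?thesis by blast
next
  case False
  have "\<phi> (star k) $ a $ b = 0" if "a \<noteq> k" "b \<noteq> k" for k a b
  proof -
    \<comment> \<open>With at most two vertices, those other than \<open>k\<close> coincide, and
      only a diagonal entry is left.\<close>
    have "card {k, a, b} \<le> CARD('n)"
      by (rule card_mono) auto
    then have "a = b"
      using False that by (auto simp: card_insert_if split: if_splits)
    then show ?thesis
      using map_mem_cone[OF star_mem_cone] by (simp add: mem_cone_iff)
  qed
  then show ?thesis
    using that[of id] by simp
qed

end

end

section \<open>Permutation matrices as bijections of the index set\<close>

lemma permutation_conjugate_entry: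
  fixes P X :: "real ^ 'n ^ 'n"
  assumes "\<And>i a. P $ i $ a = (if i = \<tau> a then 1 else 0)"
  shows "(transpose P ** X ** P) $ a $ b = X $ \<tau> a $ \<tau> b"
  by (simp add: matrix_matrix_mult_def transpose_def assms if_distrib if_distribR cong: if_cong)

text \<open>\<open>\<tau> a\<close> is the row of the 1 in column \<open>a\<close>. Uniqueness
  within rows makes \<open>\<tau>\<close> injective, hence bijective on a finite type.\<close>

lemma permutation_matrix_iff:
  fixes P :: "real ^ 'n ^ 'n"
  shows "permutation_matrix P \<longleftrightarrow>
    (\<exists>\<tau>. bij \<tau> \<and> (\<forall>i a. P $ i $ a = (if i = \<tau> a then 1 else 0)))"
proof
  assume P: "permutation_matrix P"
  then obtain \<tau> where \<tau>: "\<And>a. P $ \<tau> a $ a = 1"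
    unfolding permutation_matrix_def by metis
  have "inj \<tau>"
    using P \<tau> unfolding permutation_matrix_def inj_def by metis
  then have "bij \<tau>"
    by (simp add: bij_def finite_UNIV_inj_surj)
  moreover have "P $ i $ a = (if i = \<tau> a then 1 else 0)" for i a
    using P \<tau> unfolding permutation_matrix_def by metis
  ultimately show "\<exists>\<tau>. bij \<tau> \<and> (\<forall>i a. P $ i $ a = (if i = \<tau> a then 1 else 0))"
    by blast
next
  assume "\<exists>\<tau>. bij \<tau> \<and> (\<forall>i a. P $ i $ a = (if i = \<tau> a then 1 else 0))"
  then obtain \<tau> where \<tau>: "bij \<tau>" and P: "\<And>i a. P $ i $ a = (if i = \<tau> a then 1 else 0)"
    by blast
  have "\<exists>!a. \<tau> a = i" for i
    using \<tau> by (simp add: bij_iff)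
  moreover have "P $ i $ a = 1 \<longleftrightarrow> \<tau> a = i" for i a
    by (auto simp: P)
  ultimately show "permutation_matrix P"
    unfolding permutation_matrix_def by (simp add: P)
qed

theorem theorem1:
  fixes \<phi> :: "real ^ 'n ^ 'n \<Rightarrow> real ^ 'n ^ 'n"
  assumes "cone_linear_map \<phi>"
  shows "(\<forall>X \<in> nonneg_sym_zero_trace. independence_number (\<phi> X) = independence_number X) \<longleftrightarrow>
    (let H = \<phi> (all_ones - mat 1) in
      (\<forall>i j. i \<noteq> j \<longrightarrow> 0 < H $ i $ j) \<and>
      (\<exists>P. permutation_matrix P \<and>
        (\<forall>X \<in> nonneg_sym_zero_trace. \<phi> X = hadamard H (transpose P ** X ** P))))"
proof
  let ?H = "\<phi> (all_ones - mat 1)"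
  assume pres: "\<forall>X \<in> nonneg_sym_zero_trace. independence_number (\<phi> X) = independence_number X"
  obtain \<sigma> where \<sigma>: "bij \<sigma>"
      "\<And>k a b. a \<noteq> \<sigma> k \<Longrightarrow> b \<noteq> \<sigma> k \<Longrightarrow> \<phi> (star k) $ a $ b = 0"
    using star_image_centre_bij[OF assms pres] by blast
  \<comment> \<open>The entry formula speaks of positions \<open>\<sigma> i\<close>,
    \<open>\<sigma> j\<close>; reading it at \<open>a\<close>, \<open>b\<close> calls for
    preimages.\<close>
  define \<tau> where "\<tau> = inv \<sigma>"
  have \<tau>: "bij \<tau>" "\<And>a. \<sigma> (\<tau> a) = a"
    using \<sigma>(1) by (auto simp: \<tau>_def bij_imp_bij_inv bij_is_surj surj_f_inv_f)
  define P :: "real ^ 'n ^ 'n" where "P = (\<chi> i a. if i = \<tau> a then 1 else 0)"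
  have P: "P $ i $ a = (if i = \<tau> a then 1 else 0)" for i a
    by (simp add: P_def)
  have "\<phi> X = hadamard ?H (transpose P ** X ** P)" if X: "X \<in> nonneg_sym_zero_trace" for X
  proof -
    have "\<phi> X $ a $ b = ?H $ a $ b * X $ \<tau> a $ \<tau> b" for a b
    proof (cases "a = b")
      case True
      then show ?thesis
        using map_mem_cone[OF assms X] X by (simp add: mem_cone_iff)
    next
      case False
      then have "\<tau> a \<noteq> \<tau> b"
        using \<tau>(2) by metis
      from entry_formula[OF assms bij_is_inj[OF \<sigma>(1)] \<sigma>(2) X this]
      show ?thesis by (simp add: \<tau>(2))
    qed
    then show ?thesis
      by (simp add: hadamard_def vec_eq_iff permutation_conjugate_entry[OF P])
  qed
  moreover have "permutation_matrix P"
    using \<tau>(1) P permutation_matrix_iff by blast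
  ultimately show "let H = ?H in (\<forall>i j. i \<noteq> j \<longrightarrow> 0 < H $ i $ j) \<and>
      (\<exists>P. permutation_matrix P \<and>
        (\<forall>X \<in> nonneg_sym_zero_trace. \<phi> X = hadamard H (transpose P ** X ** P)))"
    using complete_image_pos[OF assms pres] unfolding Let_def by blast
next
  let ?H = "\<phi> (all_ones - mat 1)"
  assume "let H = ?H in (\<forall>i j. i \<noteq> j \<longrightarrow> 0 < H $ i $ j) \<and>
      (\<exists>P. permutation_matrix P \<and>
        (\<forall>X \<in> nonneg_sym_zero_trace. \<phi> X = hadamard H (transpose P ** X ** P)))"
  then have pos: "\<And>i j. i \<noteq> j \<Longrightarrow> 0 < ?H $ i $ j"
    and "\<exists>P. permutation_matrix P \<and>
      (\<forall>X \<in> nonneg_sym_zero_trace. \<phi> X = hadamard ?H (transpose P ** X ** P))"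
    by (simp_all add: Let_def)
  then obtain P where "permutation_matrix P"
    and eq: "\<And>X. X \<in> nonneg_sym_zero_trace \<Longrightarrow> \<phi> X = hadamard ?H (transpose P ** X ** P)"
    by metis
  from this(1) obtain \<tau> where \<tau>: "bij \<tau>" and P: "\<And>i a. P $ i $ a = (if i = \<tau> a then 1 else 0)"
    unfolding permutation_matrix_iff by metis
  show "\<forall>X \<in> nonneg_sym_zero_trace. independence_number (\<phi> X) = independence_number X"
  proof
    fix X :: "real ^ 'n ^ 'n" assume X: "X \<in> nonneg_sym_zero_trace"
    \<comment> \<open>Off the diagonal the factor from \<open>?H\<close> is positive, so it does not
      affect which entries vanish; on the diagonal both sides hold.\<close>
    have zero_iff: "\<phi> X $ a $ b = 0 \<longleftrightarrow> X $ \<tau> a $ \<tau> b = 0" for a b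
    proof (cases "a = b")
      case True
      then show ?thesis
        using map_mem_cone[OF assms X] X by (simp add: mem_cone_iff)
    next
      case False
      then show ?thesis
        using pos[of a b] eq[OF X] by (simp add: hadamard_def permutation_conjugate_entry[OF P])
    qed
    show "independence_number (\<phi> X) = independence_number X"
    proof (rule order_antisym)
      show "independence_number (\<phi> X) \<le> independence_number X"
        by (rule independence_number_le_reindex[OF bij_is_inj[OF \<tau>]]) (simp add: zero_iff)
      \<comment> \<open>The converse inequality reindexes along the inverse of
        \<open>\<tau>\<close>.\<close>
      show "independence_number X \<le> independence_number (\<phi> X)"
        using bij_is_surj[OF \<tau>]
        by (intro independence_number_le_reindex[OF bij_is_inj[OF bij_imp_bij_inv[OF \<tau>]]])
          (simp add: zero_iff surj_f_inv_f)
    qed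
  qed
qed

end
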